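(* Let $\langle U,\theta\rangle$ be an approximation space. Its principal rough set algebra $R_\theta$ is a core regular double Stone algebra if and only if its rough 3-valued Łukasiewicz algebra $RS(U)$ is centered, i.e. is a 3-valued Post algebra. Furthermore, in that case the center element of $RS(U)$ as a 3-valued Łukasiewicz algebra is $\langle\emptyset,U\rangle$.
   Context: An approximation space $\langle U,\theta\rangle$ is a nonempty set $U$ with an equivalence relation $\theta$; $\theta_x$ denotes the $\theta$-class of $x$. For $X\subseteq U$, $\overline{X}=\bigcup\{\theta_x:\theta_x\cap X\neq\emptyset\}$ and $\underline{X}=\bigcup\{\theta_x:\theta_x\subseteq X\}$; the pair $\langle\underline{X},\overline{X}\rangle$ is a rough set. $R_\theta$ is the set of all rough sets $\langle\underline{X},\overline{X}\rangle$, $X\subseteq U$. Complements $^c$ are in $U$. The principal rough set algebra, also denoted $R_\theta$, has $0=\langle\emptyset,\emptyset\rangle$, $1=\langle U,U\rangle$, componentwise union as $\vee$, componentwise intersection as $\wedge$, $\langle\underline{X},\overline{X}\rangle^*=\langle\overline{X}^c,\overline{X}^c\rangle$ and $\langle\underline{X},\overline{X}\rangle^+=\langle\underline{X}^c,\underline{X}^c\rangle$. A double Stone algebra $\langle L,\wedge,\vee,*,+,0,1\rangle$ is a bounded distributive lattice with unary operations such that $y\le x^*\iff y\wedge x=0$, $y\ge x^+\iff y\vee x=1$, $x^*\vee x^{**}=1$ and $x^+\wedge x^{++}=0$. It is regular if $x\wedge x^+\le y\vee y^*$ for all $x,y$. An element $x$ is dense if $x^*=0$ and dually dense if $x^+=1$;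 the core is the set of elements that are both. A core regular double Stone algebra is a regular double Stone algebra with nonempty core. A 3-valued Łukasiewicz algebra is an algebra $\langle L,\vee,\wedge,\neg,\mu,0,1\rangle$ where $\langle L,\vee,\wedge,\neg,0,1\rangle$ is a De Morgan algebra and $\neg x\vee\mu x=1$, $x\wedge\neg x=\neg x\wedge\mu x$, $\mu(x\wedge y)=\mu x\wedge\mu y$. It is centered if there is an element $c$ (called its center element; it is unique if it exists) with $\neg c=c$; a centered 3-valued Łukasiewicz algebra is called a 3-valued Post algebra. The rough 3-valued Łukasiewicz algebra $RS(U)$ of $\langle U,\theta\rangle$ has the same underlying set, $\vee,\wedge,0,1$ as $R_\theta$, with $\neg\langle\underline{X},\overline{X}\rangle=\langle\overline{X}^c,\underline{X}^c\rangle$ and $\mu\langle\underline{X},\overline{X}\rangle=\langle\overline{X},\overline{X}\rangle$. *)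

theory Defs
  imports "HOL-Algebra.Congruence"
begin

section \<open>Approximation spaces\<close>

locale approximation_space =
  fixes U :: "'a set" and \<theta> :: "('a \<times> 'a) set"
  assumes nonempty: "U \<noteq> {}"
    and equivalence: "equiv U \<theta>"

definition upper_approx :: "'a set \<Rightarrow> ('a \<times> 'a) set \<Rightarrow> 'a set \<Rightarrow> 'a set" where
  "upper_approx U \<theta> X = \<Union> {\<theta> `` {x} | x. x \<in> U \<and> \<theta> `` {x} \<inter> X \<noteq> {}}"

definition lower_approx :: "'a set \<Rightarrow> ('a \<times> 'a) set \<Rightarrow> 'a set \<Rightarrow> 'a set" where
  "lower_approx U \<theta> X = \<Union> {\<theta> `` {x} | x. x \<in> U \<and> \<theta> `` {x} \<subseteq> X}"

definition rough_sets :: "'a set \<Rightarrow> ('a \<times> 'a) set \<Rightarrow> ('a set \<times> 'a set) set" where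
  "rough_sets U \<theta> = {(lower_approx U \<theta> X, upper_approx U \<theta> X) | X. X \<subseteq> U}"


section \<open>Bounded distributive lattices as algebras\<close>

text \<open>The lattices of HOL-Algebra are orders from which join and meet are
  chosen; here the operations are part of the structure and the order is derived.\<close>

record 'a bd_lattice = "'a partial_object" +
  meet :: "'a \<Rightarrow> 'a \<Rightarrow> 'a" (infixl \<open>\<sqinter>\<index>\<close> 70)
  join :: "'a \<Rightarrow> 'a \<Rightarrow> 'a" (infixl \<open>\<squnion>\<index>\<close> 65)
  zero :: 'a (\<open>\<zero>\<index>\<close>)
  one :: 'a (\<open>\<one>\<index>\<close>)

definition le :: "('a, 'b) bd_lattice_scheme \<Rightarrow> 'a \<Rightarrow> 'a \<Rightarrow> bool" (infix \<open>\<preceq>\<index>\<close> 50) where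
  "x \<preceq>\<^bsub>L\<^esub> y \<longleftrightarrow> x \<sqinter>\<^bsub>L\<^esub> y = x"

locale bounded_distributive_lattice =
  fixes L (structure)
  assumes meet_closed: "\<lbrakk>x \<in> carrier L; y \<in> carrier L\<rbrakk> \<Longrightarrow> x \<sqinter> y \<in> carrier L"
    and join_closed: "\<lbrakk>x \<in> carrier L; y \<in> carrier L\<rbrakk> \<Longrightarrow> x \<squnion> y \<in> carrier L"
    and zero_closed: "\<zero> \<in> carrier L"
    and one_closed: "\<one> \<in> carrier L"
    and meet_assoc: "\<lbrakk>x \<in> carrier L; y \<in> carrier L; z \<in> carrier L\<rbrakk>
        \<Longrightarrow> (x \<sqinter> y) \<sqinter> z = x \<sqinter> (y \<sqinter> z)"
    and join_assoc: "\<lbrakk>x \<in> carrier L; y \<in> carrier L; z \<in> carrier L\<rbrakk>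
        \<Longrightarrow> (x \<squnion> y) \<squnion> z = x \<squnion> (y \<squnion> z)"
    and meet_comm: "\<lbrakk>x \<in> carrier L; y \<in> carrier L\<rbrakk> \<Longrightarrow> x \<sqinter> y = y \<sqinter> x"
    and join_comm: "\<lbrakk>x \<in> carrier L; y \<in> carrier L\<rbrakk> \<Longrightarrow> x \<squnion> y = y \<squnion> x"
    and meet_join_absorb: "\<lbrakk>x \<in> carrier L; y \<in> carrier L\<rbrakk> \<Longrightarrow> x \<sqinter> (x \<squnion> y) = x"
    and join_meet_absorb: "\<lbrakk>x \<in> carrier L; y \<in> carrier L\<rbrakk> \<Longrightarrow> x \<squnion> (x \<sqinter> y) = x"
    and distrib: "\<lbrakk>x \<in> carrier L; y \<in> carrier L; z \<in> carrier L\<rbrakk>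
        \<Longrightarrow> x \<sqinter> (y \<squnion> z) = (x \<sqinter> y) \<squnion> (x \<sqinter> z)"
    and zero_le: "x \<in> carrier L \<Longrightarrow> \<zero> \<preceq> x"
    and le_one: "x \<in> carrier L \<Longrightarrow> x \<preceq> \<one>"


section \<open>Double Stone algebras\<close>

text \<open>\<open>pcompl\<close> is the operation written \<open>*\<close>, and \<open>dpcompl\<close> the one written \<open>+\<close>.\<close>

record 'a double_stone = "'a bd_lattice" +
  pcompl :: "'a \<Rightarrow> 'a"
  dpcompl :: "'a \<Rightarrow> 'a"

locale double_stone_algebra = bounded_distributive_lattice L
  for L :: "('a, 'b) double_stone_scheme" (structure) +
  assumes pcompl_closed: "x \<in> carrier L \<Longrightarrow> pcompl L x \<in> carrier L"
    and dpcompl_closed: "x \<in> carrier L \<Longrightarrow> dpcompl L x \<in> carrier L"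
    and le_pcompl_iff: "\<lbrakk>x \<in> carrier L; y \<in> carrier L\<rbrakk>
        \<Longrightarrow> y \<preceq> pcompl L x \<longleftrightarrow> y \<sqinter> x = \<zero>"
    and dpcompl_le_iff: "\<lbrakk>x \<in> carrier L; y \<in> carrier L\<rbrakk>
        \<Longrightarrow> dpcompl L x \<preceq> y \<longleftrightarrow> y \<squnion> x = \<one>"
    and stone: "x \<in> carrier L \<Longrightarrow> pcompl L x \<squnion> pcompl L (pcompl L x) = \<one>"
    and dual_stone: "x \<in> carrier L \<Longrightarrow> dpcompl L x \<sqinter> dpcompl L (dpcompl L x) = \<zero>"

locale regular_double_stone_algebra = double_stone_algebra +
  assumes regular: "\<lbrakk>x \<in> carrier L; y \<in> carrier L\<rbrakk>
      \<Longrightarrow> x \<sqinter> dpcompl L x \<preceq> y \<squnion> pcompl L y"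

definition dense :: "('a, 'b) double_stone_scheme \<Rightarrow> 'a \<Rightarrow> bool" where
  "dense L x \<longleftrightarrow> x \<in> carrier L \<and> pcompl L x = \<zero>\<^bsub>L\<^esub>"

definition dually_dense :: "('a, 'b) double_stone_scheme \<Rightarrow> 'a \<Rightarrow> bool" where
  "dually_dense L x \<longleftrightarrow> x \<in> carrier L \<and> dpcompl L x = \<one>\<^bsub>L\<^esub>"

definition core :: "('a, 'b) double_stone_scheme \<Rightarrow> 'a set" where
  "core L = {x. dense L x \<and> dually_dense L x}"

locale core_regular_double_stone_algebra = regular_double_stone_algebra +
  assumes core_nonempty: "core L \<noteq> {}"


section \<open>Three-valued Lukasiewicz algebras and Post algebras\<close>

record 'a lukasiewicz3 = "'a bd_lattice" +
  neg :: "'a \<Rightarrow> 'a"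
  mu :: "'a \<Rightarrow> 'a"

locale de_morgan_algebra = bounded_distributive_lattice L
  for L :: "('a, 'b) lukasiewicz3_scheme" (structure) +
  assumes neg_closed: "x \<in> carrier L \<Longrightarrow> neg L x \<in> carrier L"
    and neg_neg: "x \<in> carrier L \<Longrightarrow> neg L (neg L x) = x"
    and neg_meet: "\<lbrakk>x \<in> carrier L; y \<in> carrier L\<rbrakk>
        \<Longrightarrow> neg L (x \<sqinter> y) = neg L x \<squnion> neg L y"

locale lukasiewicz3_algebra = de_morgan_algebra +
  assumes mu_closed: "x \<in> carrier L \<Longrightarrow> mu L x \<in> carrier L"
    and neg_join_mu: "x \<in> carrier L \<Longrightarrow> neg L x \<squnion> mu L x = \<one>"
    and meet_neg: "x \<in> carrier L \<Longrightarrow> x \<sqinter> neg L x = neg L x \<sqinter> mu L x"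
    and mu_meet: "\<lbrakk>x \<in> carrier L; y \<in> carrier L\<rbrakk> \<Longrightarrow> mu L (x \<sqinter> y) = mu L x \<sqinter> mu L y"

definition is_center :: "('a, 'b) lukasiewicz3_scheme \<Rightarrow> 'a \<Rightarrow> bool" where
  "is_center L c \<longleftrightarrow> c \<in> carrier L \<and> neg L c = c"

locale post3_algebra = lukasiewicz3_algebra +
  assumes centered: "\<exists>c. is_center L c"


section \<open>Algebras of rough sets\<close>

definition rough_set_algebra ::
    "'a set \<Rightarrow> ('a \<times> 'a) set \<Rightarrow> ('a set \<times> 'a set) double_stone" where
  "rough_set_algebra U \<theta> =
     \<lparr>carrier = rough_sets U \<theta>,
      meet = (\<lambda>(A, B) (C, D). (A \<inter> C, B \<inter> D)),
      join = (\<lambda>(A, B) (C, D). (A \<union> C, B \<union> D)),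
      zero = ({}, {}),
      one = (U, U),
      pcompl = (\<lambda>(A, B). (U - B, U - B)),
      dpcompl = (\<lambda>(A, B). (U - A, U - A))\<rparr>"

definition rough_lukasiewicz_algebra ::
    "'a set \<Rightarrow> ('a \<times> 'a) set \<Rightarrow> ('a set \<times> 'a set) lukasiewicz3" where
  "rough_lukasiewicz_algebra U \<theta> =
     \<lparr>carrier = carrier (rough_set_algebra U \<theta>),
      meet = meet (rough_set_algebra U \<theta>),
      join = join (rough_set_algebra U \<theta>),
      zero = zero (rough_set_algebra U \<theta>),
      one = one (rough_set_algebra U \<theta>),
      neg = (\<lambda>(A, B). (U - B, U - A)),
      mu = (\<lambda>(A, B). (B, B))\<rparr>"

end

theory Submission
  imports Defs
begin

text \<open>A pair \<open>(A, B)\<close> of unions of \<open>\<theta>\<close>-classes with \<open>A \<subseteq> B\<close> is a rough set iff no singleton class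
  lies in \<open>B - A\<close>: for the converse, adjoin to \<open>A\<close> one representative of each class in \<open>B - A\<close>.
  This condition is preserved by all the operations, so the two algebras always are a regular double
  Stone algebra and a 3-valued Lukasiewicz algebra. A core element and a center element are both
  forced to be \<open>({}, U)\<close>, so core and center exist exactly when \<open>({}, U)\<close> is a rough set.\<close>

context approximation_space
begin

text \<open>Classes that share a point coincide, so the class witnessing membership of
  \<open>x\<close> may be taken to be its own.\<close>

lemma mem_upper_approx_iff: "x \<in> upper_approx U \<theta> X \<longleftrightarrow> x \<in> U \<and> \<theta> `` {x} \<inter> X \<noteq> {}"
proof
  assume "x \<in> upper_approx U \<theta> X"
  then obtain y where "x \<in> \<theta> `` {y}" "\<theta> `` {y} \<inter> X \<noteq> {}"
    unfolding upper_approx_def by blast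
  moreover from this have "\<theta> `` {x} = \<theta> `` {y}"
    using equiv_class_eq[OF equivalence] by blast
  ultimately show "x \<in> U \<and> \<theta> `` {x} \<inter> X \<noteq> {}"
    using equiv_type[OF equivalence] by blast
qed (use equiv_class_self[OF equivalence] in \<open>unfold upper_approx_def, blast\<close>)

lemma mem_lower_approx_iff: "x \<in> lower_approx U \<theta> X \<longleftrightarrow> x \<in> U \<and> \<theta> `` {x} \<subseteq> X"
proof
  assume "x \<in> lower_approx U \<theta> X"
  then obtain y where "x \<in> \<theta> `` {y}" "\<theta> `` {y} \<subseteq> X"
    unfolding lower_approx_def by blast
  moreover from this have "\<theta> `` {x} = \<theta> `` {y}"
    using equiv_class_eq[OF equivalence] by blast
  ultimately show "x \<in> U \<and> \<theta> `` {x} \<subseteq> X"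
    using equiv_type[OF equivalence] by blast
qed (use equiv_class_self[OF equivalence] in \<open>unfold lower_approx_def, blast\<close>)

text \<open>These are the unions of \<open>\<theta>\<close>-classes, phrased as closure under
  \<open>\<theta>\<close> so that no family of classes has to be exhibited.\<close>

definition saturated :: "'a set \<Rightarrow> bool" where
  "saturated S \<longleftrightarrow> S \<subseteq> U \<and> \<theta> `` S \<subseteq> S"

lemma saturated_Int: "\<lbrakk>saturated A; saturated B\<rbrakk> \<Longrightarrow> saturated (A \<inter> B)"
  unfolding saturated_def by blast

lemma saturated_Un: "\<lbrakk>saturated A; saturated B\<rbrakk> \<Longrightarrow> saturated (A \<union> B)"
  unfolding saturated_def by blast

text \<open>Symmetry is the key: a \<open>\<theta>\<close>-step from \<open>U - A\<close> into
  \<open>A\<close> would reverse to a step leaving \<open>A\<close>.\<close>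

lemma saturated_compl: "saturated A \<Longrightarrow> saturated (U - A)"
  using equiv_type[OF equivalence] equivE[OF equivalence]
  unfolding saturated_def sym_def by blast

lemma saturated_empty: "saturated {}"
  unfolding saturated_def by blast

lemma saturated_space: "saturated U"
  using saturated_compl[OF saturated_empty] by simp

lemma saturated_upper_approx: "saturated (upper_approx U \<theta> X)"
  using equiv_class_eq[OF equivalence] equiv_type[OF equivalence]
  unfolding saturated_def by (auto simp: mem_upper_approx_iff)

lemma saturated_lower_approx: "saturated (lower_approx U \<theta> X)"
  using equiv_class_eq[OF equivalence] equiv_type[OF equivalence]
  unfolding saturated_def by (auto simp: mem_lower_approx_iff)

lemma rough_sets_iff:
  "(A, B) \<in> rough_sets U \<theta> \<longleftrightarrow>
     saturated A \<and> saturated B \<and> A \<subseteq> B \<and> (\<forall>x\<in>B - A. \<theta> `` {x} \<noteq> {x})"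
proof
  assume "(A, B) \<in> rough_sets U \<theta>"
  then obtain X where "A = lower_approx U \<theta> X" "B = upper_approx U \<theta> X"
    unfolding rough_sets_def by blast
  then have "saturated A" "saturated B"
    and A: "x \<in> A \<longleftrightarrow> x \<in> U \<and> \<theta> `` {x} \<subseteq> X"
    and B: "x \<in> B \<longleftrightarrow> x \<in> U \<and> \<theta> `` {x} \<inter> X \<noteq> {}" for x
    by (simp_all add: saturated_lower_approx saturated_upper_approx
        mem_lower_approx_iff mem_upper_approx_iff)
  moreover have "A \<subseteq> B"
  proof
    fix x assume "x \<in> A"
    then show "x \<in> B" unfolding A B using equiv_class_self[OF equivalence, of x] by blast
  qed
  \<comment> \<open>A one-point class that meets \<open>X\<close> is already contained in
    \<open>X\<close>.\<close>
  moreover have "\<theta> `` {x} \<noteq> {x}" if "x \<in> B - A" for x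
  proof
    assume singleton: "\<theta> `` {x} = {x}"
    show False using that A[of x] B[of x] unfolding singleton by auto
  qed
  ultimately show "saturated A \<and> saturated B \<and> A \<subseteq> B \<and> (\<forall>x\<in>B - A. \<theta> `` {x} \<noteq> {x})"
    by simp
next
  assume *: "saturated A \<and> saturated B \<and> A \<subseteq> B \<and> (\<forall>x\<in>B - A. \<theta> `` {x} \<noteq> {x})"
  then have closed: "\<And>x y. x \<in> A \<Longrightarrow> (x, y) \<in> \<theta> \<Longrightarrow> y \<in> A" "\<And>x y. x \<in> B \<Longrightarrow> (x, y) \<in> \<theta> \<Longrightarrow> y \<in> B"
    and sub: "A \<subseteq> U" "B \<subseteq> U" "A \<subseteq> B"
    unfolding saturated_def by blast+
  have sym: "\<And>x y. (x, y) \<in> \<theta> \<Longrightarrow> (y, x) \<in> \<theta>"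
    using equivE[OF equivalence] unfolding sym_def by blast
  \<comment> \<open>The choice depends only on the class as a set, so equivalent points get the same
    representative.\<close>
  define r where "r x = (SOME y. y \<in> \<theta> `` {x})" for x
  have r: "(x, r x) \<in> \<theta>" if "x \<in> U" for x
    using someI[of "\<lambda>y. y \<in> \<theta> `` {x}"] equiv_class_self[OF equivalence that]
    unfolding r_def by blast
  have r_eq: "r x = r y" if "(x, y) \<in> \<theta>" for x y
    using equiv_class_eq[OF equivalence that] unfolding r_def by simp
  define X where "X = A \<union> r ` (B - A)"
  have "X \<subseteq> B"
    using closed(2)[OF _ r] sub unfolding X_def by blast
  have "upper_approx U \<theta> X = B"
  proof (intro subset_antisym subsetI)
    fix x assume "x \<in> upper_approx U \<theta> X"
    then obtain y where "(x, y) \<in> \<theta>" "y \<in> X"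
      by (auto simp: mem_upper_approx_iff)
    then show "x \<in> B" using \<open>X \<subseteq> B\<close> closed(2) sym by blast
  next
    fix x assume "x \<in> B"
    then have "x \<in> U" using sub by blast
    \<comment> \<open>The first case is \<open>x \<in> A\<close>, the second
      \<open>x \<in> B - A\<close>; either way the class of \<open>x\<close> meets
      \<open>X\<close>.\<close>
    have "x \<in> X \<or> r x \<in> X" using \<open>x \<in> B\<close> unfolding X_def by blast
    then show "x \<in> upper_approx U \<theta> X"
      using \<open>x \<in> U\<close> r[of x] equiv_class_self[OF equivalence \<open>x \<in> U\<close>]
      unfolding mem_upper_approx_iff by blast
  qed
  moreover have "lower_approx U \<theta> X = A"
  proof (intro subset_antisym subsetI)
    fix x assume "x \<in> lower_approx U \<theta> X"
    then have x: "x \<in> U" "\<theta> `` {x} \<subseteq> X"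
      by (auto simp: mem_lower_approx_iff)
    show "x \<in> A"
    proof (rule ccontr)
      assume "x \<notin> A"
      \<comment> \<open>By saturation the class of \<open>x\<close> misses \<open>A\<close>, so
        inside \<open>X\<close> it has only chosen representatives, and a class has just one. It is
        thus a singleton within \<open>B - A\<close>, which is excluded.\<close>
      have rep: "y = r x" if "(x, y) \<in> \<theta>" for y
      proof -
        have "y \<in> X" using x(2) that by blast
        moreover have "y \<notin> A" using closed(1) sym[OF that] \<open>x \<notin> A\<close> by blast
        ultimately obtain z where "z \<in> B" "y = r z" unfolding X_def by blast
        then have "(z, y) \<in> \<theta>" using r[of z] sub by auto
        then show ?thesis using r_eq[of z y] r_eq[OF that] \<open>y = r z\<close> by simp
      qed
      have "x \<in> \<theta> `` {x}" using equiv_class_self[OF equivalence x(1)] .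
      moreover have "\<theta> `` {x} \<subseteq> {r x}" using rep by auto
      ultimately have "\<theta> `` {x} = {x}" using subset_singletonD by fastforce
      moreover have "x \<in> B"
        using \<open>x \<in> \<theta> `` {x}\<close> x(2) \<open>X \<subseteq> B\<close> by blast
      ultimately show False using * \<open>x \<notin> A\<close> by simp
    qed
  next
    fix x assume "x \<in> A"
    then show "x \<in> lower_approx U \<theta> X"
      using closed(1)[of x] sub(1) unfolding mem_lower_approx_iff X_def by blast
  qed
  ultimately show "(A, B) \<in> rough_sets U \<theta>"
    using \<open>X \<subseteq> B\<close> sub(2) unfolding rough_sets_def by auto
qed

lemma rough_sets_subset: "(A, B) \<in> rough_sets U \<theta> \<Longrightarrow> A \<subseteq> B \<and> B \<subseteq> U"
  by (simp add: rough_sets_iff saturated_def)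

text \<open>The difference of the new components lies in \<open>(B - A) \<union> (D - C)\<close>, so
  no singleton class can enter it. The same holds for unions.\<close>

lemma rough_sets_Int:
  "\<lbrakk>(A, B) \<in> rough_sets U \<theta>; (C, D) \<in> rough_sets U \<theta>\<rbrakk> \<Longrightarrow> (A \<inter> C, B \<inter> D) \<in> rough_sets U \<theta>"
  unfolding rough_sets_iff by (blast intro: saturated_Int)

lemma rough_sets_Un:
  "\<lbrakk>(A, B) \<in> rough_sets U \<theta>; (C, D) \<in> rough_sets U \<theta>\<rbrakk> \<Longrightarrow> (A \<union> C, B \<union> D) \<in> rough_sets U \<theta>"
  unfolding rough_sets_iff by (blast intro: saturated_Un)

lemma rough_sets_exact: "saturated A \<Longrightarrow> (A, A) \<in> rough_sets U \<theta>"
  unfolding rough_sets_iff by blast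

text \<open>Since \<open>B \<subseteq> U\<close>, the difference of the new components is
  \<open>B - A\<close> again.\<close>

lemma rough_sets_compl: "(A, B) \<in> rough_sets U \<theta> \<Longrightarrow> (U - B, U - A) \<in> rough_sets U \<theta>"
  unfolding rough_sets_iff by (blast intro: saturated_compl)

text \<open>These give closure under \<open>mu\<close>, \<open>dpcompl\<close> and
  \<open>pcompl\<close>, in this order.\<close>

lemma rough_sets_exact_parts:
  assumes "(A, B) \<in> rough_sets U \<theta>"
  shows "(B, B) \<in> rough_sets U \<theta>" "(U - A, U - A) \<in> rough_sets U \<theta>"
    "(U - B, U - B) \<in> rough_sets U \<theta>"
  using assms by (simp_all add: rough_sets_iff saturated_compl)

lemmas rough_sets_closed =
  rough_sets_Int rough_sets_Un rough_sets_compl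
  rough_sets_exact[OF saturated_empty] rough_sets_exact[OF saturated_space]

text \<open>Beyond closure, only set algebra with \<open>A \<subseteq> B \<subseteq> U\<close>
  remains. Regularity holds because the left side has first component \<open>{}\<close> and the
  right side has second component \<open>U\<close>.\<close>

lemma regular_double_stone_rough_set_algebra:
  "regular_double_stone_algebra (rough_set_algebra U \<theta>)"
  by (unfold_locales; clarsimp simp: rough_set_algebra_def le_def rough_sets_closed;
      (erule rough_sets_exact_parts | (drule rough_sets_subset)+, blast))

lemma lukasiewicz3_rough_lukasiewicz_algebra:
  "lukasiewicz3_algebra (rough_lukasiewicz_algebra U \<theta>)"
  by (unfold_locales;
      clarsimp simp: rough_lukasiewicz_algebra_def rough_set_algebra_def le_def rough_sets_closed;
      (erule rough_sets_exact_parts | (drule rough_sets_subset)+, blast))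

text \<open>Density forces \<open>B = U\<close> and dual density \<open>A = {}\<close>. The
  intersection is needed because \<open>({}, U)\<close> fails to be a rough set when some class is a
  singleton.\<close>

lemma core_rough_set_algebra:
  "core (rough_set_algebra U \<theta>) = {({}, U)} \<inter> rough_sets U \<theta>"
proof -
  have "U - B = {} \<and> U - A = U \<longleftrightarrow> A = {} \<and> B = U" if "(A, B) \<in> rough_sets U \<theta>" for A B
    using rough_sets_subset[OF that] by auto
  then show ?thesis
    by (auto simp: core_def dense_def dually_dense_def rough_set_algebra_def)
qed

text \<open>A fixed point of \<open>neg\<close> has \<open>A = U - B\<close>; together with
  \<open>A \<subseteq> B\<close> this leaves only \<open>A = {}\<close> and
  \<open>B = U\<close>.\<close>

lemma is_center_rough_lukasiewicz_algebra_iff: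
  "is_center (rough_lukasiewicz_algebra U \<theta>) c \<longleftrightarrow> c = ({}, U) \<and> c \<in> rough_sets U \<theta>"
  by (cases c)
    (auto simp: is_center_def rough_set_algebra_def rough_lukasiewicz_algebra_def
      dest: rough_sets_subset)

end

theorem proposition4:
  fixes U :: "'a set" and \<theta> :: "('a \<times> 'a) set"
  assumes "approximation_space U \<theta>"
  shows "(core_regular_double_stone_algebra (rough_set_algebra U \<theta>)
            \<longleftrightarrow> post3_algebra (rough_lukasiewicz_algebra U \<theta>))
       \<and> (post3_algebra (rough_lukasiewicz_algebra U \<theta>)
            \<longrightarrow> (\<forall>c. is_center (rough_lukasiewicz_algebra U \<theta>) c \<longleftrightarrow> c = ({}, U)))"
proof -
  interpret approximation_space U \<theta> by (rule assms)
  have "core_regular_double_stone_algebra (rough_set_algebra U \<theta>) \<longleftrightarrow> ({}, U) \<in> rough_sets U \<theta>"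
    by (auto simp: core_regular_double_stone_algebra_def core_regular_double_stone_algebra_axioms_def
        regular_double_stone_rough_set_algebra core_rough_set_algebra)
  moreover have "post3_algebra (rough_lukasiewicz_algebra U \<theta>) \<longleftrightarrow> ({}, U) \<in> rough_sets U \<theta>"
    by (auto simp: post3_algebra_def post3_algebra_axioms_def
        lukasiewicz3_rough_lukasiewicz_algebra is_center_rough_lukasiewicz_algebra_iff)
  ultimately show ?thesis
    by (auto simp: is_center_rough_lukasiewicz_algebra_iff)
qed

end
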